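(* Let $E$ be an infinite-dimensional Banach space. Then there exist a sequence $(e_k^* )_{k\in\mathbb{N}}$ of functionals in the dual space $E^*$ with $\|e_k^*\|=1$ for every $k\in\mathbb{N}$, and a partition $\mathbb{N}=\bigcup_{m\in\mathbb{N}}I_m$ of $\mathbb{N}$ into finite intervals, such that $$\sum_{m\in\mathbb{N}}\frac{\big|\big\{i\in I_m : |e_i^*(e)|\ge 1/m\big\}\big|}{|I_m|}<\infty$$ for every vector $e\in E$ with $\|e\|=1$.
   Context: $\mathbb{N}=\{1,2,3,\ldots\}$ denotes the set of positive integers; an interval in $\mathbb{N}$ is a set of consecutive positive integers, and the members $I_m$ of the partition are nonempty and pairwise disjoint. $|S|$ denotes the cardinality of a finite set $S$. *)

theory Defs
  imports "HOL-Analysis.Analysis"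
begin

text \<open>
  The scalars range over the sort \<open>{real_normed_field, euclidean_space}\<close>. By the theorem of
  Frobenius (or Gelfand--Mazur) its instances are, up to isomorphism, exactly the real and the
  complex numbers. The class \<open>banach\<close> only knows scalar multiplication by reals, so the
  multiplication by scalars is a parameter that is required to extend it and to be
  compatible with the norm. For real scalars it is forced to be \<open>scaleR\<close> and the dual
  is the whole type of bounded linear functionals, as shown below.
\<close>

locale banach_space_over = vector_space smul
  for smul :: "'k :: {real_normed_field, euclidean_space} \<Rightarrow> 'a :: banach \<Rightarrow> 'a" +
  assumes smul_of_real: "smul (of_real r) x = r *\<^sub>R x"
    and norm_smul: "norm (smul c x) = norm c * norm x"

definition infinite_dimensional ::
    "('k :: {real_normed_field, euclidean_space} \<Rightarrow> 'a :: banach \<Rightarrow> 'a) \<Rightarrow> bool" where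
  "infinite_dimensional smul \<longleftrightarrow> \<not> (\<exists>B. finite B \<and> module.span smul B = UNIV)"

text \<open>
  Elements of \<open>'a \<Rightarrow>\<^sub>L 'k\<close> are bounded and linear over the reals; the operator norm does not
  depend on the scalar field.
\<close>

definition dual_space ::
    "('k :: {real_normed_field, euclidean_space} \<Rightarrow> 'a :: banach \<Rightarrow> 'a) \<Rightarrow> ('a \<Rightarrow>\<^sub>L 'k) set" where
  "dual_space smul = {f. Vector_Spaces.linear smul (*) (blinfun_apply f)}"

lemma banach_space_over_real_iff:
  fixes smul :: "real \<Rightarrow> 'a :: banach \<Rightarrow> 'a"
  shows "banach_space_over smul \<longleftrightarrow> smul = (*\<^sub>R)"
proof
  assume "banach_space_over smul"
  then show "smul = (*\<^sub>R)"
    using banach_space_over.smul_of_real[of smul] by (intro ext) simp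
next
  have "banach_space_over ((*\<^sub>R) :: real \<Rightarrow> 'a \<Rightarrow> 'a)"
    by unfold_locales (simp_all add: algebra_simps)
  then show "smul = (*\<^sub>R) \<Longrightarrow> banach_space_over smul" by simp
qed

lemma dual_space_real:
  "dual_space ((*\<^sub>R) :: real \<Rightarrow> 'a :: banach \<Rightarrow> 'a) = UNIV"
proof -
  have "Vector_Spaces.linear (*\<^sub>R) (*) (blinfun_apply f)" for f :: "'a \<Rightarrow>\<^sub>L real"
    by unfold_locales
       (simp_all add: blinfun.add_right blinfun.scaleR_right algebra_simps)
  then show ?thesis by (auto simp: dual_space_def)
qed

lemma banach_space_over_complex: "banach_space_over ((*) :: complex \<Rightarrow> complex \<Rightarrow> complex)"
  by unfold_locales (simp_all add: algebra_simps norm_mult scaleR_conv_of_real)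

end

theory Submission
  imports Defs
begin

text \<open>
  The heart of the matter is that an infinite-dimensional real normed space carries, for every
  \<open>\<delta> > 0\<close>, a finite nonempty list of norm-one functionals whose squares have average at most
  \<open>\<delta>\<close> at every point of the unit ball (\<open>square_summing_unit_functionals\<close>). By Chebyshev's inequality
  the proportion of these functionals that exceed \<open>1 / m\<close> at a given unit vector is at most
  \<open>\<delta> m\<^sup>2\<close>, so \<open>\<delta> = 1 / m\<^sup>4\<close> makes the proportion at most \<open>1 / m\<^sup>2\<close>. Writing such lists one
  after the other, with the \<open>m\<close>-th list occupying the interval \<open>I m\<close>, gives a convergent series.

  The averaging statement is a form of the Dvoretzky--Rogers phenomenon, and the argument is a
  duality in the style of Pietsch. Suppose it fails for some \<open>\<delta>\<close>: however finitely many unit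
  functionals are chosen, some point of the unit ball makes the average of their squares exceed
  \<open>\<delta>\<close>. The Hahn--Banach theorem turns these points, which depend on the chosen functionals, into
  one single linear functional \<open>L\<close> on the bounded bilinear forms on the space which acts like
  integration of the diagonal \<open>\<phi>(e, e)\<close> against a probability on the unit ball and which
  satisfies \<open>L (f \<otimes> f) \<ge> \<delta> \<parallel>f\<parallel>\<^sup>2\<close> for all functionals \<open>f\<close> (\<open>dominating_form_exists\<close>). So
  \<open>\<langle>f, g\<rangle> = L (f \<otimes> g)\<close> is an inner product on the dual whose norm dominates
  \<open>sqrt \<delta>\<close> times the dual norm.
  As the dual is infinite-dimensional, there are \<open>n\<close> orthonormal functionals
  \<open>h\<^sub>1, \<dots>, h\<^sub>n\<close> for each \<open>n\<close> (\<open>orthonormal_functionals\<close>). Domination yields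
  \<open>\<Sum> h\<^sub>i(e)\<^sup>2 \<le> 1 / \<delta>\<close> on the unit ball, and applying \<open>L\<close> gives \<open>n \<le> 1 / \<delta>\<close>, which is absurd
  for large \<open>n\<close>.

  For a general scalar field \<open>'k\<close> the real result is applied to the underlying real space. A real
  functional \<open>g\<close> extends to a scalar-linear functional of the same norm, whose squared modulus at
  \<open>e\<close> is the sum of the squares of \<open>g\<close> at the multiples of \<open>e\<close> by an orthonormal basis of the
  scalars (\<open>scalar_extension\<close>). This costs only the factor \<open>DIM('k)\<close> in \<open>\<delta>\<close>.
\<close>

section \<open>The Hahn--Banach theorem\<close>

text \<open>
  Homogeneity is required as an inequality because the infima formed below satisfy the inequality
  directly; the equality follows from it by rescaling.
\<close>

definition sublinear :: "('v :: real_vector \<Rightarrow> real) \<Rightarrow> bool" where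
  "sublinear p \<longleftrightarrow> (\<forall>x y. p (x + y) \<le> p x + p y) \<and> (\<forall>c>0. \<forall>x. p (c *\<^sub>R x) \<le> c * p x)"

lemma sublinear_add: "sublinear p \<Longrightarrow> p (x + y) \<le> p x + p y"
  by (simp add: sublinear_def)

lemma sublinear_zero:
  assumes "sublinear p" shows "p 0 = 0"
proof -
  have "p (0 + 0) \<le> p 0 + p 0"
    using assms by (rule sublinear_add)
  moreover have "p ((1/2) *\<^sub>R 0) \<le> (1/2) * p 0"
    using assms unfolding sublinear_def by (meson half_gt_zero zero_less_one)
  ultimately show ?thesis by simp
qed

lemma sublinear_scale:
  assumes "sublinear p" "0 \<le> c" shows "p (c *\<^sub>R x) = c * p x"
proof (cases "c = 0")
  case True
  then show ?thesis using sublinear_zero[OF assms(1)] by simp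
next
  case False
  with assms(2) have c: "c > 0" by simp
  have scale: "p (d *\<^sub>R y) \<le> d * p y" if "d > 0" for d y
    using assms(1) that by (simp add: sublinear_def)
  have "p (inverse c *\<^sub>R (c *\<^sub>R x)) \<le> inverse c * p (c *\<^sub>R x)"
    using c by (intro scale) simp
  then have "c * p x \<le> p (c *\<^sub>R x)"
    using c by (simp add: field_simps)
  with scale[OF c, of x] show ?thesis by simp
qed

lemma sublinear_minus:
  assumes "sublinear p" shows "- p (- x) \<le> p x"
  using sublinear_add[OF assms, of x "- x"] sublinear_zero[OF assms] by simp

text \<open>
  Pushing \<open>p\<close> down in the direction \<open>y\<close>: this is the largest sublinear functional below \<open>p\<close> whose
  value at \<open>- y\<close> is at most \<open>- p y\<close>. Every linear functional below it therefore agrees with \<open>p\<close>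
  at \<open>y\<close>.
\<close>

definition tilt :: "('v :: real_vector \<Rightarrow> real) \<Rightarrow> 'v \<Rightarrow> 'v \<Rightarrow> real" where
  "tilt p y x = (INF t\<in>{0..}. p (x + t *\<^sub>R y) - t * p y)"

lemma tilt_lower:
  assumes "sublinear p" "0 \<le> t"
  shows "- p (- x) \<le> p (x + t *\<^sub>R y) - t * p y"
  using sublinear_add[OF assms(1), of "x + t *\<^sub>R y" "- x"] sublinear_scale[OF assms, of y]
  by simp

lemma tilt_le:
  assumes "sublinear p" "0 \<le> t"
  shows "tilt p y x \<le> p (x + t *\<^sub>R y) - t * p y"
  unfolding tilt_def
proof (rule cINF_lower)
  show "bdd_below ((\<lambda>t. p (x + t *\<^sub>R y) - t * p y) ` {0..})"
    using tilt_lower[OF assms(1)] by (intro bdd_belowI2[of _ "- p (- x)"]) auto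
qed (use assms(2) in simp)

lemma tilt_sublinear:
  assumes p: "sublinear p" shows "sublinear (tilt p y)"
  unfolding sublinear_def
proof (intro conjI allI impI)
  fix x z
  have step: "tilt p y (x + z) \<le> (p (x + t *\<^sub>R y) - t * p y) + (p (z + s *\<^sub>R y) - s * p y)"
    if "0 \<le> t" "0 \<le> s" for s t
  proof -
    have "tilt p y (x + z) \<le> p ((x + z) + (t + s) *\<^sub>R y) - (t + s) * p y"
      using p that by (intro tilt_le) auto
    also have "(x + z) + (t + s) *\<^sub>R y = (x + t *\<^sub>R y) + (z + s *\<^sub>R y)"
      by (simp add: algebra_simps)
    also have "p \<dots> - (t + s) * p y \<le> (p (x + t *\<^sub>R y) - t * p y) + (p (z + s *\<^sub>R y) - s * p y)"
      using sublinear_add[OF p, of "x + t *\<^sub>R y" "z + s *\<^sub>R y"] by (simp add: algebra_simps)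
    finally show ?thesis .
  qed
  have "tilt p y (x + z) - tilt p y x \<le> p (z + s *\<^sub>R y) - s * p y" if "0 \<le> s" for s
  proof -
    have "tilt p y (x + z) - (p (z + s *\<^sub>R y) - s * p y) \<le> tilt p y x"
      unfolding tilt_def[of p y x]
    proof (rule cINF_greatest)
      fix t :: real assume "t \<in> {0..}"
      then show "tilt p y (x + z) - (p (z + s *\<^sub>R y) - s * p y) \<le> p (x + t *\<^sub>R y) - t * p y"
        using step[of t s] that by simp
    qed simp
    then show ?thesis by simp
  qed
  then have "tilt p y (x + z) - tilt p y x \<le> tilt p y z"
    unfolding tilt_def[of p y z] by (intro cINF_greatest) auto
  then show "tilt p y (x + z) \<le> tilt p y x + tilt p y z" by simp
next
  fix c :: real and x assume c: "0 < c"
  have "tilt p y (c *\<^sub>R x) / c \<le> tilt p y x"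
    unfolding tilt_def[of p y x]
  proof (rule cINF_greatest)
    fix t :: real assume t: "t \<in> {0..}"
    have "tilt p y (c *\<^sub>R x) \<le> p (c *\<^sub>R x + (c * t) *\<^sub>R y) - (c * t) * p y"
      using p c t by (intro tilt_le) auto
    also have "c *\<^sub>R x + (c * t) *\<^sub>R y = c *\<^sub>R (x + t *\<^sub>R y)"
      by (simp add: algebra_simps)
    also have "p \<dots> - (c * t) * p y = c * (p (x + t *\<^sub>R y) - t * p y)"
      using sublinear_scale[OF p, of c "x + t *\<^sub>R y"] c by (simp only: right_diff_distrib mult.assoc)
    finally show "tilt p y (c *\<^sub>R x) / c \<le> p (x + t *\<^sub>R y) - t * p y"
      using c by (simp add: field_simps)
  qed simp
  then show "tilt p y (c *\<^sub>R x) \<le> c * tilt p y x"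
    using c by (simp add: field_simps)
qed

text \<open>
  Zorn's lemma applies because the pointwise infimum of a chain of sublinear functionals below
  \<open>p\<close> is again sublinear: all of them are bounded below at \<open>x\<close> by \<open>- p (- x)\<close>.
\<close>

lemma minimal_sublinear_exists:
  fixes p :: "'v :: real_vector \<Rightarrow> real"
  assumes p: "sublinear p"
  shows "\<exists>q. sublinear q \<and> q \<le> p \<and> (\<forall>r. sublinear r \<longrightarrow> r \<le> q \<longrightarrow> r = q)"
proof -
  define S where "S = {q. sublinear q \<and> q \<le> p}"
  have "\<exists>m\<in>S. \<forall>a\<in>S. a \<le> m \<longrightarrow> a = m"
  proof (rule predicate_Zorn)
    show "partial_order_on S (relation_of (\<lambda>x y. y \<le> x) S)"
      by (rule partial_order_on_relation_ofI) auto
    fix C assume C: "C \<in> Chains (relation_of (\<lambda>x y. y \<le> x) S)"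
    then have CS: "C \<subseteq> S" and chain: "\<And>a b. a \<in> C \<Longrightarrow> b \<in> C \<Longrightarrow> a \<le> b \<or> b \<le> a"
      unfolding Chains_def relation_of_def by auto
    show "\<exists>u\<in>S. \<forall>a\<in>C. u \<le> a"
    proof (cases "C = {}")
      case True
      then show ?thesis using p unfolding S_def by auto
    next
      case False
      define u where "u = (\<lambda>x. INF q\<in>C. q x)"
      have low: "- p (- x) \<le> q x" if "q \<in> C" for q x
      proof -
        have "sublinear q" "q (- x) \<le> p (- x)"
          using that CS unfolding S_def le_fun_def by auto
        then show ?thesis using sublinear_minus[of q x] by linarith
      qed
      have u_le: "u x \<le> q x" if "q \<in> C" for q x
        unfolding u_def using that low by (intro cINF_lower bdd_belowI2[of _ "- p (- x)"]) auto
      have u_ge: "b \<le> u x" if "\<And>q. q \<in> C \<Longrightarrow> b \<le> q x" for b x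
        unfolding u_def using that False by (intro cINF_greatest) auto
      have subl: "sublinear q" if "q \<in> C" for q
        using that CS unfolding S_def by auto
      have "sublinear u"
        unfolding sublinear_def
      proof (intro conjI allI impI)
        fix x y
        have "u (x + y) \<le> q x + r y" if qr: "q \<in> C" "r \<in> C" for q r
        proof -
          obtain s where s: "s \<in> C" "s \<le> q" "s \<le> r"
            using chain qr by blast
          have "u (x + y) \<le> s (x + y)" using s u_le by blast
          also have "\<dots> \<le> s x + s y" using subl s by (intro sublinear_add)
          also have "\<dots> \<le> q x + r y" using s by (simp add: add_mono le_fun_def)
          finally show ?thesis .
        qed
        then have "u (x + y) - r y \<le> u x" if "r \<in> C" for r
          using that by (intro u_ge) (simp add: algebra_simps)
        then have "u (x + y) - u x \<le> u y"
          by (intro u_ge) (simp add: algebra_simps)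
        then show "u (x + y) \<le> u x + u y" by simp
      next
        fix c :: real and x assume c: "0 < c"
        have "u (c *\<^sub>R x) / c \<le> u x"
        proof (rule u_ge)
          fix q assume q: "q \<in> C"
          have "u (c *\<^sub>R x) \<le> c * q x"
            using u_le[OF q, of "c *\<^sub>R x"] sublinear_scale[OF subl[OF q], of c x] c by simp
          then show "u (c *\<^sub>R x) / c \<le> q x" using c by (simp add: field_simps)
        qed
        then show "u (c *\<^sub>R x) \<le> c * u x" using c by (simp add: field_simps)
      qed
      moreover have "u \<le> p"
      proof -
        obtain q where "q \<in> C" using False by auto
        then have "u \<le> q" "q \<le> p" using u_le CS unfolding S_def by (auto simp: le_fun_def)
        then show ?thesis by simp
      qed
      ultimately show ?thesis
        using u_le unfolding S_def by (auto simp: le_fun_def)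
    qed
  qed
  then show ?thesis unfolding S_def by (auto intro: order_trans)
qed

text \<open>
  A minimal \<open>q\<close> equals all its tilts. The parameter \<open>t = 1\<close> in the tilt then gives
  \<open>q x \<le> q (x + y) - q y\<close>, that is, superadditivity.
\<close>

lemma minimal_sublinear_linear:
  fixes q :: "'v :: real_vector \<Rightarrow> real"
  assumes q: "sublinear q" and min: "\<And>r. sublinear r \<Longrightarrow> r \<le> q \<Longrightarrow> r = q"
  shows "linear q"
proof -
  have tilt: "tilt q y = q" for y
    using tilt_sublinear[OF q] tilt_le[OF q, of 0] by (intro min) (auto simp: le_fun_def)
  have add: "q (x + y) = q x + q y" for x y
  proof -
    have "q x \<le> q (x + y) - q y"
      using tilt_le[OF q, of 1 y x] by (simp add: tilt)
    then show ?thesis using sublinear_add[OF q, of x y] by simp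
  qed
  have minus: "q (- x) = - q x" for x
    using add[of x "- x"] sublinear_zero[OF q] by simp
  have "q (c *\<^sub>R x) = c * q x" for c x
  proof (cases "0 \<le> c")
    case True
    then show ?thesis by (rule sublinear_scale[OF q])
  next
    case False
    then have "q ((- c) *\<^sub>R x) = - c * q x" by (intro sublinear_scale[OF q]) simp
    then show ?thesis using minus[of "c *\<^sub>R x"] by simp
  qed
  then show ?thesis using add by (intro linearI) auto
qed

theorem hahn_banach_sublinear:
  fixes p :: "'v :: real_vector \<Rightarrow> real"
  assumes p: "sublinear p"
  obtains L where "linear L" "\<And>x. L x \<le> p x" "L y = p y"
proof -
  obtain L where L: "sublinear L" "L \<le> tilt p y" "\<And>r. sublinear r \<Longrightarrow> r \<le> L \<Longrightarrow> r = L"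
    using minimal_sublinear_exists[OF tilt_sublinear[OF p, of y]] by blast
  have lin: "linear L" using L by (intro minimal_sublinear_linear) auto
  have le: "L x \<le> p x" for x
    using L(2) tilt_le[OF p, of 0 y x] by (auto simp: le_fun_def intro: order_trans)
  have "L (- y) \<le> - p y"
    using L(2) tilt_le[OF p, of 1 y "- y"] sublinear_zero[OF p]
    by (auto simp: le_fun_def intro: order_trans)
  then have "L y = p y"
    using linear_neg[OF lin, of y] le[of y] by simp
  with lin le show ?thesis by (rule that)
qed

corollary norming_functional:
  fixes x :: "'a :: real_normed_vector"
  obtains f :: "'a \<Rightarrow>\<^sub>L real" where "blinfun_apply f x = norm x"
proof -
  have "sublinear (norm :: 'a \<Rightarrow> real)"
    by (simp add: sublinear_def norm_triangle_ineq)
  then obtain L :: "'a \<Rightarrow> real" where L: "linear L" "\<And>z. L z \<le> norm z" "L x = norm x"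
    using hahn_banach_sublinear by blast
  have "norm (L z) \<le> norm z * 1" for z
    using L(2)[of z] L(2)[of "- z"] linear_neg[OF L(1), of z] by simp
  then have "bounded_linear L"
    using L(1) by (intro bounded_linear_intro[of L 1]) (auto simp: linear_add linear_cmul)
  then show ?thesis using that[of "Blinfun L"] L(3) by (simp add: bounded_linear_Blinfun_apply)
qed

section \<open>Common kernels of finitely many functionals\<close>

text \<open>
  Each further functional enlarges a complement of the common kernel by at most one vector,
  on which that functional does not vanish.
\<close>

lemma common_kernel_finite_codim:
  fixes fs :: "('a :: real_normed_vector \<Rightarrow>\<^sub>L real) list"
  shows "\<exists>B. finite B \<and> (\<forall>x. \<exists>y\<in>span B. \<forall>f\<in>set fs. blinfun_apply f (x - y) = 0)"
proof (induction fs)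
  case Nil
  show ?case by (rule exI[of _ "{}"]) simp
next
  case (Cons g fs)
  then obtain B where B: "finite B"
    "\<And>x. \<exists>y\<in>span B. \<forall>f\<in>set fs. blinfun_apply f (x - y) = 0"
    by blast
  show ?case
  proof (cases "\<exists>z. (\<forall>f\<in>set fs. blinfun_apply f z = 0) \<and> blinfun_apply g z \<noteq> 0")
    case False
    have "\<exists>y\<in>span B. \<forall>f\<in>set (g # fs). blinfun_apply f (x - y) = 0" for x
      using B(2)[of x] False by auto
    with B(1) show ?thesis by blast
  next
    case True
    then obtain z where z: "\<forall>f\<in>set fs. blinfun_apply f z = 0" "blinfun_apply g z \<noteq> 0"
      by blast
    have "\<exists>y\<in>span (insert z B). \<forall>f\<in>set (g # fs). blinfun_apply f (x - y) = 0" for x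
    proof -
      obtain y where y: "y \<in> span B" "\<forall>f\<in>set fs. blinfun_apply f (x - y) = 0"
        using B(2) by blast
      define c where "c = blinfun_apply g (x - y) / blinfun_apply g z"
      have "y + c *\<^sub>R z \<in> span (insert z B)"
        using y(1) by (intro span_add span_scale) (auto intro: span_base span_mono[THEN subsetD, rotated])
      moreover have "blinfun_apply f (x - (y + c *\<^sub>R z)) = 0" if "f \<in> set (g # fs)" for f
      proof -
        have "blinfun_apply f (x - (y + c *\<^sub>R z)) = blinfun_apply f (x - y) - c * blinfun_apply f z"
          by (simp add: blinfun.diff_right blinfun.add_right blinfun.scaleR_right)
        then show ?thesis using that y(2) z by (auto simp: c_def)
      qed
      ultimately show ?thesis by blast
    qed
    with B(1) show ?thesis by (intro exI[of _ "insert z B"]) auto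
  qed
qed

lemma common_kernel_nonzero:
  fixes fs :: "('a :: real_normed_vector \<Rightarrow>\<^sub>L real) list"
  assumes "\<not> (\<exists>B :: 'a set. finite B \<and> span B = UNIV)"
  obtains x where "x \<noteq> 0" "\<forall>f\<in>set fs. blinfun_apply f x = 0"
proof -
  obtain B where B: "finite B" "\<And>x. \<exists>y\<in>span B. \<forall>f\<in>set fs. blinfun_apply f (x - y) = 0"
    using common_kernel_finite_codim[of fs] by blast
  obtain x where x: "x \<notin> span B" using assms B(1) by blast
  obtain y where y: "y \<in> span B" "\<forall>f\<in>set fs. blinfun_apply f (x - y) = 0"
    using B(2) by blast
  from x y(1) have "x - y \<noteq> 0" by auto
  then show ?thesis using y(2) by (rule that)
qed

section \<open>Unit functionals with small average of squares\<close>

abbreviation tensor :: "('a :: real_normed_vector \<Rightarrow>\<^sub>L real) \<Rightarrow> ('a \<Rightarrow>\<^sub>L real) \<Rightarrow> 'a \<Rightarrow>\<^sub>L 'a \<Rightarrow>\<^sub>L real"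
  where "tensor f g \<equiv> blinfun_scaleR_left g o\<^sub>L f"

lemma blinfun_apply_bound:
  assumes "norm e \<le> 1" shows "norm (blinfun_apply f e) \<le> norm f"
  using norm_blinfun[of f e] mult_left_mono[OF assms, of "norm f"] by simp

text \<open>
  The functionals in the list have arbitrary norms, so that a positive multiple of an excess is
  again an excess; the norm squared acts as the weight of the normalised functional.
\<close>

definition excess :: "real \<Rightarrow> ('a :: real_normed_vector \<Rightarrow>\<^sub>L real) list \<Rightarrow> 'a \<Rightarrow> real" where
  "excess \<delta> xs e = (\<Sum>f\<leftarrow>xs. (blinfun_apply f e)\<^sup>2 - \<delta> * (norm f)\<^sup>2)"

lemma excess_append: "excess \<delta> (xs @ ys) e = excess \<delta> xs e + excess \<delta> ys e"
  by (simp add: excess_def)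

lemma excess_scale:
  assumes "0 \<le> c"
  shows "excess \<delta> (map (scaleR (sqrt c)) xs) e = c * excess \<delta> xs e"
  using assms
  by (induction xs)
     (simp_all add: excess_def blinfun.scaleR_left power_mult_distrib algebra_simps)

text \<open>
  The hypothesis on lists of unit functionals passes to arbitrary lists by approximation: a
  functional \<open>f\<close> is replaced by about \<open>M \<parallel>f\<parallel>\<^sup>2\<close> copies of its normalisation. Rounding costs
  at most \<open>1\<close> for each \<open>f\<close>, which is negligible after division by a large \<open>M\<close>.
\<close>

lemma excess_nearly_nonneg:
  fixes xs :: "('a :: real_normed_vector \<Rightarrow>\<^sub>L real) list" and \<delta> :: real
  assumes large: "\<And>ys :: ('a \<Rightarrow>\<^sub>L real) list. ys \<noteq> [] \<Longrightarrow> \<forall>f\<in>set ys. norm f = 1 \<Longrightarrow>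
      \<exists>e. norm e \<le> 1 \<and> \<delta> * real (length ys) < (\<Sum>f\<leftarrow>ys. (blinfun_apply f e)\<^sup>2)"
    and \<delta>: "0 \<le> \<delta>" and \<eta>: "0 < \<eta>"
  shows "\<exists>e. norm e \<le> 1 \<and> - \<eta> \<le> excess \<delta> xs e"
proof -
  define M where "M = (length xs + 1) / \<eta>"
  have M: "0 < M" using \<eta> by (simp add: M_def)
  define c where "c f = nat \<lceil>M * (norm f)\<^sup>2\<rceil>" for f :: "'a \<Rightarrow>\<^sub>L real"
  define ys where "ys = concat (map (\<lambda>f. replicate (c f) (f /\<^sub>R norm f)) xs)"
  have unit: "\<forall>g\<in>set ys. norm g = 1"
  proof
    fix g assume "g \<in> set ys"
    then obtain f where "c f \<noteq> 0" "g = f /\<^sub>R norm f"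
      by (auto simp: ys_def split: if_splits)
    moreover from this have "f \<noteq> 0" by (auto simp: c_def)
    ultimately show "norm g = 1" by simp
  qed
  have "\<exists>e. norm e \<le> 1 \<and> 0 \<le> (\<Sum>g\<leftarrow>ys. (blinfun_apply g e)\<^sup>2 - \<delta>)"
  proof (cases "ys = []")
    case True
    then show ?thesis by (intro exI[of _ 0]) simp
  next
    case False
    from large[OF False unit] show ?thesis
      by (auto simp: sum_list_subtractf sum_list_triv algebra_simps intro: less_imp_le)
  qed
  then obtain e where e: "norm e \<le> 1" "0 \<le> (\<Sum>g\<leftarrow>ys. (blinfun_apply g e)\<^sup>2 - \<delta>)" by blast
  have one: "c f * ((blinfun_apply (f /\<^sub>R norm f) e)\<^sup>2 - \<delta>)
      \<le> M * ((blinfun_apply f e)\<^sup>2 - \<delta> * (norm f)\<^sup>2) + 1" for f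
  proof (cases "f = 0")
    case True
    then show ?thesis by (simp add: c_def)
  next
    case False
    define a where "a = (blinfun_apply (f /\<^sub>R norm f) e)\<^sup>2"
    have "norm (blinfun_apply (f /\<^sub>R norm f) e) \<le> norm (f /\<^sub>R norm f)"
      using e(1) by (rule blinfun_apply_bound)
    then have "\<bar>blinfun_apply (f /\<^sub>R norm f) e\<bar> \<le> 1" using False by simp
    then have a: "0 \<le> a" "a \<le> 1" by (auto simp: a_def abs_square_le_1)
    have fa: "(blinfun_apply f e)\<^sup>2 = (norm f)\<^sup>2 * a"
      using False by (simp add: a_def blinfun.scaleR_left power_mult_distrib field_simps)
    have c: "M * (norm f)\<^sup>2 \<le> c f" "c f \<le> M * (norm f)\<^sup>2 + 1"
      using M by (auto simp: c_def) 
    have "c f * a \<le> (M * (norm f)\<^sup>2 + 1) * a" using c a by (intro mult_right_mono) auto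
    also have "\<dots> \<le> M * (norm f)\<^sup>2 * a + 1" using a by (simp add: algebra_simps)
    finally have "c f * a \<le> M * (norm f)\<^sup>2 * a + 1" .
    moreover have "M * (norm f)\<^sup>2 * \<delta> \<le> c f * \<delta>" using c \<delta> by (intro mult_right_mono) auto
    ultimately show ?thesis unfolding fa a_def[symmetric] by (simp add: algebra_simps)
  qed
  have "(\<Sum>g\<leftarrow>ys. (blinfun_apply g e)\<^sup>2 - \<delta>)
      = (\<Sum>f\<leftarrow>xs. c f * ((blinfun_apply (f /\<^sub>R norm f) e)\<^sup>2 - \<delta>))"
    unfolding ys_def by (induction xs) (simp_all add: sum_list_replicate)
  also have "\<dots> \<le> (\<Sum>f\<leftarrow>xs. M * ((blinfun_apply f e)\<^sup>2 - \<delta> * (norm f)\<^sup>2) + 1)"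
    using one by (intro sum_list_mono)
  also have "\<dots> = M * excess \<delta> xs e + length xs"
    by (simp add: excess_def sum_list_addf sum_list_const_mult sum_list_triv)
  finally have "0 \<le> M * excess \<delta> xs e + length xs" using e(2) by simp
  then have "0 \<le> excess \<delta> xs e + length xs / M" using M by (simp add: field_simps)
  moreover have "length xs / M \<le> \<eta>" using \<eta> by (simp add: M_def field_simps)
  ultimately show ?thesis using e(1) by (intro exI[of _ e]) auto
qed

text \<open>
  The linear functional is obtained by the Hahn--Banach theorem below the sublinear functional
  \<open>p(\<phi>)\<close>, the infimum over finite lists \<open>f\<^sub>1, \<dots>, f\<^sub>k\<close> of functionals of the supremum of
  \<open>\<phi>(e, e) + \<Sum> f\<^sub>j(e)\<^sup>2 - \<delta> \<Sum> \<parallel>f\<^sub>j\<parallel>\<^sup>2\<close> over the unit ball.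
  Taking no \<open>f\<close> at all shows that \<open>p(\<phi>)\<close> is at most the supremum of \<open>\<phi>\<close> on the diagonal of the
  unit ball; taking the single functional \<open>f\<close> shows \<open>p(- f \<otimes> f) \<le> - \<delta> \<parallel>f\<parallel>\<^sup>2\<close>. The hypothesis is
  what makes \<open>p\<close> finite.
\<close>

lemma dominating_form_exists:
  fixes \<delta> :: real
  assumes large: "\<And>ys :: ('a :: real_normed_vector \<Rightarrow>\<^sub>L real) list. ys \<noteq> [] \<Longrightarrow> \<forall>f\<in>set ys. norm f = 1 \<Longrightarrow>
      \<exists>e. norm e \<le> 1 \<and> \<delta> * real (length ys) < (\<Sum>f\<leftarrow>ys. (blinfun_apply f e)\<^sup>2)"
    and \<delta>: "0 \<le> \<delta>"
  obtains L :: "('a :: real_normed_vector \<Rightarrow>\<^sub>L 'a \<Rightarrow>\<^sub>L real) \<Rightarrow> real" where "linear L"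
    "\<And>\<phi> r. (\<And>e. norm e \<le> 1 \<Longrightarrow> blinfun_apply (blinfun_apply \<phi> e) e \<le> r) \<Longrightarrow> L \<phi> \<le> r"
    "\<And>f. \<delta> * (norm f)\<^sup>2 \<le> L (tensor f f)"
proof -
  \<comment> \<open>The upper bounds admitted by some list; one infimum over them replaces the infimum of suprema.\<close>
  define U where "U \<phi> = {r. \<exists>xs. \<forall>e. norm e \<le> 1 \<longrightarrow>
      blinfun_apply (blinfun_apply \<phi> e) e + excess \<delta> xs e \<le> r}" for \<phi> :: "'a \<Rightarrow>\<^sub>L 'a \<Rightarrow>\<^sub>L real"
  define p where "p \<phi> = Inf (U \<phi>)" for \<phi>
  have UI: "r \<in> U \<phi>" if "\<And>e. norm e \<le> 1 \<Longrightarrow> blinfun_apply (blinfun_apply \<phi> e) e \<le> r" for r \<phi>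
    using that unfolding U_def by (auto simp: excess_def intro!: exI[of _ "[]"])
  have diag: "\<bar>blinfun_apply (blinfun_apply \<phi> e) e\<bar> \<le> norm \<phi>" if "norm e \<le> 1"
    for e and \<phi> :: "'a \<Rightarrow>\<^sub>L 'a \<Rightarrow>\<^sub>L real"
    using blinfun_apply_bound[OF that, of "blinfun_apply \<phi> e"] blinfun_apply_bound[OF that, of \<phi>]
    by simp
  have nonempty: "U \<phi> \<noteq> {}" for \<phi>
    using UI[of \<phi> "norm \<phi>"] diag[of _ \<phi>] by (auto simp: abs_le_iff)
  \<comment> \<open>The hypothesis on unit functionals enters here: the infimum over all lists stays finite.\<close>
  have lower: "- norm \<phi> \<le> r" if r: "r \<in> U \<phi>" for r \<phi>
  proof (rule field_le_epsilon)
    fix \<eta> :: real assume \<eta>: "0 < \<eta>"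
    obtain xs where xs: "\<And>e. norm e \<le> 1 \<Longrightarrow> blinfun_apply (blinfun_apply \<phi> e) e + excess \<delta> xs e \<le> r"
      using r unfolding U_def by blast
    obtain e where e: "norm e \<le> 1" "- \<eta> \<le> excess \<delta> xs e"
      using excess_nearly_nonneg[OF large \<delta> \<eta>] by blast
    show "- norm \<phi> \<le> r + \<eta>"
      using xs[OF e(1)] diag[OF e(1), of \<phi>] e(2) by linarith
  qed
  have p_le: "p \<phi> \<le> r" if "r \<in> U \<phi>" for r \<phi>
    unfolding p_def using that lower by (intro cInf_lower bdd_belowI[of _ "- norm \<phi>"])
  have p_ge: "b \<le> p \<phi>" if "\<And>r. r \<in> U \<phi> \<Longrightarrow> b \<le> r" for b \<phi>
    unfolding p_def using that nonempty by (intro cInf_greatest)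
  have "sublinear p"
    unfolding sublinear_def
  proof (intro conjI allI impI)
    fix \<phi> \<psi>
    have "p (\<phi> + \<psi>) \<le> r + s" if rs: "r \<in> U \<phi>" "s \<in> U \<psi>" for r s
    proof -
      obtain xs where xs: "\<And>e. norm e \<le> 1 \<Longrightarrow> blinfun_apply (blinfun_apply \<phi> e) e + excess \<delta> xs e \<le> r"
        using rs unfolding U_def by blast
      obtain ys where ys: "\<And>e. norm e \<le> 1 \<Longrightarrow> blinfun_apply (blinfun_apply \<psi> e) e + excess \<delta> ys e \<le> s"
        using rs unfolding U_def by blast
      have "blinfun_apply (blinfun_apply (\<phi> + \<psi>) e) e + excess \<delta> (xs @ ys) e \<le> r + s"
        if "norm e \<le> 1" for e
        using xs[OF that] ys[OF that] by (simp add: blinfun.add_left excess_append)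
      then have "r + s \<in> U (\<phi> + \<psi>)" unfolding U_def by blast
      then show ?thesis by (rule p_le)
    qed
    then have "p (\<phi> + \<psi>) - s \<le> p \<phi>" if "s \<in> U \<psi>" for s
      using that by (intro p_ge) (simp add: algebra_simps)
    then have "p (\<phi> + \<psi>) - p \<phi> \<le> p \<psi>"
      by (intro p_ge) (simp add: algebra_simps)
    then show "p (\<phi> + \<psi>) \<le> p \<phi> + p \<psi>" by simp
  next
    fix c :: real and \<phi> assume c: "0 < c"
    have "p (c *\<^sub>R \<phi>) / c \<le> p \<phi>"
    proof (rule p_ge)
      fix r assume "r \<in> U \<phi>"
      then obtain xs where xs: "\<And>e. norm e \<le> 1 \<Longrightarrow> blinfun_apply (blinfun_apply \<phi> e) e + excess \<delta> xs e \<le> r"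
        unfolding U_def by blast
      have "blinfun_apply (blinfun_apply (c *\<^sub>R \<phi>) e) e + excess \<delta> (map (scaleR (sqrt c)) xs) e \<le> c * r"
        if "norm e \<le> 1" for e
        using mult_left_mono[OF xs[OF that], of c] c
        by (simp add: blinfun.scaleR_left excess_scale algebra_simps)
      then have "c * r \<in> U (c *\<^sub>R \<phi>)" unfolding U_def by blast
      then have "p (c *\<^sub>R \<phi>) \<le> c * r" by (rule p_le)
      then show "p (c *\<^sub>R \<phi>) / c \<le> r" using c by (simp add: field_simps)
    qed
    then show "p (c *\<^sub>R \<phi>) \<le> c * p \<phi>" using c by (simp add: field_simps)
  qed
  then obtain L where L: "linear L" "\<And>\<phi>. L \<phi> \<le> p \<phi>"
    using hahn_banach_sublinear by blast
  have "\<delta> * (norm f)\<^sup>2 \<le> L (tensor f f)" for f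
  proof -
    have "- \<delta> * (norm f)\<^sup>2 \<in> U (- tensor f f)"
      unfolding U_def
      by (auto simp: excess_def blinfun.minus_left blinfun.scaleR_left power2_eq_square intro!: exI[of _ "[f]"])
    from p_le[OF this] L(2)[of "- tensor f f"] linear_neg[OF L(1)] show ?thesis by simp
  qed
  moreover have "L \<phi> \<le> r" if "\<And>e. norm e \<le> 1 \<Longrightarrow> blinfun_apply (blinfun_apply \<phi> e) e \<le> r" for \<phi> r
    using L(2)[of \<phi>] p_le[OF UI[OF that]] by linarith
  ultimately show ?thesis using L(1) that by blast
qed

lemma tensor_left: "linear (\<lambda>f. tensor f g)" and tensor_right: "linear (tensor f)"
  by (auto intro!: linearI blinfun_eqI simp: blinfun.scaleR_left blinfun.add_left algebra_simps)

text \<open>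
  The induction step of the Gram--Schmidt process needs a functional outside the span of the
  previous ones. Such a functional is one that norms a nonzero vector of their common kernel, and
  subtracting its projections does not change its value at that vector.
\<close>

lemma orthonormal_functionals:
  fixes L :: "('a :: real_normed_vector \<Rightarrow>\<^sub>L 'a \<Rightarrow>\<^sub>L real) \<Rightarrow> real"
  assumes inf: "\<not> (\<exists>B :: 'a set. finite B \<and> span B = UNIV)"
    and L: "linear L"
    and sym: "\<And>f g. L (tensor f g) = L (tensor g f)"
    and pos: "\<And>f. f \<noteq> 0 \<Longrightarrow> 0 < L (tensor f f)"
  shows "\<exists>h. \<forall>i<n::nat. \<forall>j<n. L (tensor (h i) (h j)) = of_bool (i = j)"
proof (induction n)
  case (Suc n)
  then obtain h where h: "\<And>i j. i < n \<Longrightarrow> j < n \<Longrightarrow> L (tensor (h i) (h j)) = of_bool (i = j)"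
    by blast
  define P where "P f g = L (tensor f g)" for f g
  have linl: "linear (\<lambda>f. P f g)" and linr: "linear (P f)" for f g
    unfolding P_def using linear_compose[OF tensor_left L] linear_compose[OF tensor_right L]
    by (auto simp: o_def)
  obtain x where x: "x \<noteq> 0" "\<forall>f\<in>set (map h [0..<n]). blinfun_apply f x = 0"
    using common_kernel_nonzero[OF inf] by blast
  obtain g where g: "blinfun_apply g x = norm x" using norming_functional by blast
  define v where "v = g - (\<Sum>i<n. P g (h i) *\<^sub>R h i)"
  have "blinfun_apply v x = norm x"
    using x(2) by (simp add: v_def blinfun.diff_left blinfun.sum_left blinfun.scaleR_left g)
  with x(1) have "v \<noteq> 0" by auto
  then have v: "0 < P v v" unfolding P_def by (rule pos)
  have vh: "P v (h j) = 0" if "j < n" for j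
  proof -
    have "P v (h j) = P g (h j) - (\<Sum>i<n. P g (h i) * P (h i) (h j))"
      by (simp add: v_def linear_diff[OF linl] linear_sum[OF linl] linear_cmul[OF linl])
    also have "(\<Sum>i<n. P g (h i) * P (h i) (h j)) = (\<Sum>i<n. if i = j then P g (h j) else 0)"
      using h that by (intro sum.cong) (auto simp: P_def)
    finally show ?thesis using that by simp
  qed
  define w where "w = v /\<^sub>R sqrt (P v v)"
  have ww: "P w w = 1"
    using v by (simp add: w_def linear_cmul[OF linl] linear_cmul[OF linr] field_simps)
  have wh: "P w (h j) = 0" "P (h j) w = 0" if "j < n" for j
  proof -
    show "P w (h j) = 0" using vh[OF that] by (simp add: w_def linear_cmul[OF linl])
    then show "P (h j) w = 0" by (simp add: P_def sym)
  qed
  have "P ((h(n := w)) i) ((h(n := w)) j) = of_bool (i = j)" if "i < Suc n" "j < Suc n" for i j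
    using that h ww wh by (auto simp: less_Suc_eq P_def)
  then show ?case unfolding P_def by blast
qed simp

text \<open>
  If this fails, then \<open>L (f \<otimes> f) \<ge> \<delta> \<parallel>f\<parallel>\<^sup>2\<close> for a functional \<open>L\<close> that averages over the diagonal
  of the unit ball. At \<open>\<Sum> h\<^sub>i \<otimes> h\<^sub>i\<close>, for an orthonormal family of
  \<open>n\<close> functionals, the value of \<open>L\<close> is \<open>n\<close> by orthonormality and at most \<open>1 / \<delta>\<close> by
  domination.
\<close>

theorem square_summing_unit_functionals:
  fixes \<delta> :: real
  assumes inf: "\<not> (\<exists>B :: 'a :: real_normed_vector set. finite B \<and> span B = UNIV)"
    and \<delta>: "0 < \<delta>"
  obtains ys :: "('a :: real_normed_vector \<Rightarrow>\<^sub>L real) list" where "ys \<noteq> []" "\<And>f. f \<in> set ys \<Longrightarrow> norm f = 1"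
    "\<And>e. norm e \<le> 1 \<Longrightarrow> (\<Sum>f\<leftarrow>ys. (blinfun_apply f e)\<^sup>2) \<le> \<delta> * real (length ys)"
proof (rule ccontr)
  assume "\<not> thesis"
  with that have large: "\<exists>e. norm e \<le> 1 \<and> \<delta> * real (length ys) < (\<Sum>f\<leftarrow>ys. (blinfun_apply f e)\<^sup>2)"
    if "ys \<noteq> []" "\<forall>f\<in>set ys. norm f = 1" for ys :: "('a \<Rightarrow>\<^sub>L real) list"
    using that by (meson not_le)
  obtain L :: "('a \<Rightarrow>\<^sub>L 'a \<Rightarrow>\<^sub>L real) \<Rightarrow> real" where L: "linear L"
    and below: "\<And>\<phi> r. (\<And>e. norm e \<le> 1 \<Longrightarrow> blinfun_apply (blinfun_apply \<phi> e) e \<le> r) \<Longrightarrow> L \<phi> \<le> r"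
    and above: "\<And>f. \<delta> * (norm f)\<^sup>2 \<le> L (tensor f f)"
    using dominating_form_exists[OF large less_imp_le[OF \<delta>]] by blast
  \<comment> \<open>\<open>L\<close> only sees the diagonal, where \<open>f \<otimes> g\<close> and \<open>g \<otimes> f\<close> coincide.\<close>
  have sym: "L (tensor f g) = L (tensor g f)" for f g
  proof -
    have "L (tensor f g) \<le> L (tensor g f)" for f g
      using below[of "tensor f g - tensor g f" 0]
      by (simp add: linear_diff[OF L] blinfun.diff_left blinfun.scaleR_left)
    then show ?thesis by (meson antisym)
  qed
  have pos: "0 < L (tensor f f)" if "f \<noteq> 0" for f
    using above[of f] \<delta> that by (smt (verit) mult_pos_pos zero_less_norm_iff zero_less_power)
  obtain n :: nat where n: "1 / \<delta> < n" using reals_Archimedean2 by blast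
  obtain h where "\<forall>i<n. \<forall>j<n. L (tensor (h i) (h j)) = of_bool (i = j)"
    using orthonormal_functionals[OF inf L sym pos, of n] by (rule exE)
  then have h: "L (tensor (h i) (h j)) = of_bool (i = j)" if "i < n" "j < n" for i j
    using that by simp
  have "L (\<Sum>i<n. tensor (h i) (h i)) \<le> 1 / \<delta>"
  proof (rule below)
    fix e :: 'a assume e: "norm e \<le> 1"
    \<comment> \<open>Testing domination on the combination \<open>f\<close> of the \<open>h i\<close> with coefficients \<open>h i e\<close>: both
      \<open>f e\<close> and \<open>L (f \<otimes> f)\<close> equal \<open>s\<close>, so \<open>\<delta> s\<^sup>2 \<le> \<delta> \<parallel>f\<parallel>\<^sup>2 \<le> s\<close>.\<close>
    define s where "s = (\<Sum>i<n. (blinfun_apply (h i) e)\<^sup>2)"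
    define f where "f = (\<Sum>i<n. blinfun_apply (h i) e *\<^sub>R h i)"
    have "L (tensor f f) = (\<Sum>i<n. \<Sum>j<n. blinfun_apply (h i) e * blinfun_apply (h j) e * L (tensor (h i) (h j)))"
      unfolding f_def linear_sum[OF tensor_left] linear_sum[OF tensor_right] linear_sum[OF L]
        linear_cmul[OF tensor_left] linear_cmul[OF tensor_right] linear_cmul[OF L]
      by (simp add: sum_distrib_left algebra_simps)
    also have "\<dots> = (\<Sum>i<n. \<Sum>j<n. if j = i then (blinfun_apply (h i) e)\<^sup>2 else 0)"
      using h by (intro sum.cong refl) (auto simp: power2_eq_square)
    also have "\<dots> = s" by (simp add: s_def)
    finally have Lf: "L (tensor f f) = s" .
    have fe: "blinfun_apply f e = s"
      by (simp add: f_def s_def blinfun.sum_left blinfun.scaleR_left power2_eq_square)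
    have s0: "0 \<le> s" by (simp add: s_def sum_nonneg)
    have "s \<le> norm f" using blinfun_apply_bound[OF e, of f] fe by simp
    then have "\<delta> * s\<^sup>2 \<le> \<delta> * (norm f)\<^sup>2" using s0 \<delta> by (intro mult_left_mono power_mono) auto
    also have "\<dots> \<le> s" using above[of f] Lf by simp
    finally have "s * (\<delta> * s) \<le> s * 1" by (simp add: power2_eq_square algebra_simps)
    then have "\<delta> * s \<le> 1" using s0 by (cases "s = 0") auto
    then have "s \<le> 1 / \<delta>" using \<delta> by (simp add: field_simps)
    then show "blinfun_apply (blinfun_apply (\<Sum>i<n. tensor (h i) (h i)) e) e \<le> 1 / \<delta>"
      by (simp add: s_def blinfun.sum_left blinfun.scaleR_left power2_eq_square)
  qed
  moreover have "L (\<Sum>i<n. tensor (h i) (h i)) = n"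
    using h by (simp add: linear_sum[OF L])
  ultimately show False using n by simp
qed

section \<open>From real to general scalars\<close>

text \<open>
  Complex conjugation, expressed by the norm alone so that the real and the complex scalars are
  treated at once. It is the identity on real scalars.
\<close>

definition conj_scalar :: "'k :: {real_normed_field, euclidean_space} \<Rightarrow> 'k" where
  "conj_scalar c = (norm c)\<^sup>2 *\<^sub>R inverse c"

lemma norm_conj_scalar [simp]: "norm (conj_scalar c) = norm c"
  by (cases "c = 0") (simp_all add: conj_scalar_def norm_inverse power2_eq_square)

lemma conj_scalar_conj_scalar [simp]: "conj_scalar (conj_scalar c) = c"
  unfolding conj_scalar_def[of "conj_scalar c"] norm_conj_scalar
  by (cases "c = 0") (simp_all add: conj_scalar_def inverse_scaleR_distrib)

lemma conj_scalar_mult: "conj_scalar (c * d) = conj_scalar c * conj_scalar d"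
  by (simp add: conj_scalar_def norm_mult power_mult_distrib)

lemma conj_scalar_of_real: "conj_scalar (of_real r) = of_real r"
  by (cases "r = 0")
     (simp_all add: conj_scalar_def scaleR_conv_of_real power2_eq_square flip: of_real_mult of_real_inverse)

text \<open>
  Multiplication by \<open>c\<close> scales the Euclidean norm by \<open>\<parallel>c\<parallel>\<close>, hence the inner product by
  \<open>\<parallel>c\<parallel>\<^sup>2\<close>, by polarisation.
\<close>

lemma inner_mult_mult:
  fixes c x y :: "'k :: {real_normed_field, euclidean_space}"
  shows "inner (c * x) (c * y) = (norm c)\<^sup>2 * inner x y"
proof -
  have "norm (c * x + c * y) = norm c * norm (x + y)"
    by (metis distrib_left norm_mult)
  then show ?thesis
    by (simp add: dot_norm norm_mult power_mult_distrib algebra_simps diff_divide_distrib)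
qed

text \<open>
  A scalar multiple of an isometry has its inverse, suitably rescaled, as adjoint. The additivity
  of conjugation, which its definition hides, is inherited from that of the adjoint.
\<close>

lemma inner_mult_conj_scalar: "inner (c * x) y = inner x (conj_scalar c * y)"
proof (cases "c = 0")
  case False
  then have "inner (c * x) y = inner (c * x) (c * (inverse c * y))"
    by (simp add: mult.assoc[symmetric])
  also have "\<dots> = inner x (conj_scalar c * y)"
    unfolding inner_mult_mult by (simp add: conj_scalar_def)
  finally show ?thesis .
qed (simp add: conj_scalar_def)

lemma conj_scalar_add: "conj_scalar (c + d) = conj_scalar c + conj_scalar d"
proof -
  have "inner x (conj_scalar (c + d)) = inner x (conj_scalar c + conj_scalar d)" for x
    using inner_mult_conj_scalar[of "c + d" x 1] inner_mult_conj_scalar[of c x 1]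
      inner_mult_conj_scalar[of d x 1]
    by (simp add: distrib_right inner_add_left inner_add_right)
  then show ?thesis using vector_eq_ldot by blast
qed

text \<open>
  The familiar formula \<open>g(e) - \<i> g(\<i> e)\<close> without reference to a particular basis of the scalars:
  the vector \<open>t e\<close> represents the real functional \<open>c \<mapsto> g(c e)\<close> on the scalars through the inner
  product, \<open>t\<close> is conjugate-linear by the adjoint formula, and the extension is its conjugate.
\<close>

lemma scalar_extension:
  fixes smul :: "'k :: {real_normed_field, euclidean_space} \<Rightarrow> 'a :: banach \<Rightarrow> 'a"
    and g :: "'a \<Rightarrow>\<^sub>L real"
  assumes "banach_space_over smul"
  obtains F :: "'a \<Rightarrow>\<^sub>L 'k" where "F \<in> dual_space smul" "norm F = norm g"
    "\<And>e. (norm (blinfun_apply F e))\<^sup>2 = (\<Sum>b\<in>Basis. (blinfun_apply g (smul b e))\<^sup>2)"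
proof -
  interpret V: banach_space_over smul by fact
  have smul_scaleR: "smul (r *\<^sub>R c) e = r *\<^sub>R smul c e" for r c e
    using V.smul_of_real[of r "smul c e"] by (simp add: scaleR_conv_of_real)
  define t where "t e = (\<Sum>b\<in>Basis. blinfun_apply g (smul b e) *\<^sub>R b)" for e
  have t: "inner (t e) c = blinfun_apply g (smul c e)" for e c
  proof -
    have "inner (t e) c = (\<Sum>b\<in>Basis. inner c b * blinfun_apply g (smul b e))"
      by (simp add: t_def inner_sum_left inner_commute[of c] mult.commute)
    also have "\<dots> = blinfun_apply g (\<Sum>b\<in>Basis. smul (inner c b *\<^sub>R b) e)"
      by (simp add: smul_scaleR blinfun.sum_right blinfun.scaleR_right)
    also have "(\<Sum>b\<in>Basis. smul (inner c b *\<^sub>R b) e) = smul c e"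
      by (simp add: V.scale_sum_left[symmetric] euclidean_representation)
    finally show ?thesis .
  qed
  have t_add: "t (x + y) = t x + t y" for x y
    by (simp add: t_def V.scale_right_distrib blinfun.add_right scaleR_left_distrib sum.distrib)
  have t_smul: "t (smul c e) = conj_scalar c * t e" for c e
  proof -
    have "inner d (t (smul c e)) = inner d (conj_scalar c * t e)" for d
    proof -
      have "inner d (t (smul c e)) = inner (t e) (c * d)"
        using t[of "smul c e" d] t[of e "c * d"] by (simp add: inner_commute mult.commute)
      also have "\<dots> = inner (c * d) (t e)" by (rule inner_commute)
      finally show ?thesis by (simp only: inner_mult_conj_scalar)
    qed
    then show ?thesis using vector_eq_ldot by blast
  qed
  \<comment> \<open>Testing with \<open>c = t e\<close> gives \<open>\<parallel>t e\<parallel>\<^sup>2 = g(t e \<cdot> e)\<close>, as in the complex Hahn--Banach theorem.\<close>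
  have t_norm: "norm (t e) \<le> norm g * norm e" for e
  proof -
    have "norm (t e) * norm (t e) = blinfun_apply g (smul (t e) e)"
      using t[of e "t e"] by (simp add: power2_norm_eq_inner[symmetric] power2_eq_square)
    also have "\<dots> \<le> norm g * (norm (t e) * norm e)"
      using norm_blinfun[of g "smul (t e) e"] by (simp add: V.norm_smul)
    finally have "norm (t e) * norm (t e) \<le> norm (t e) * (norm g * norm e)"
      by (simp add: algebra_simps)
    then show ?thesis by (cases "t e = 0") auto
  qed
  define F where "F = Blinfun (\<lambda>e. conj_scalar (t e))"
  have "bounded_linear (\<lambda>e. conj_scalar (t e))"
  proof (rule bounded_linear_intro[of _ "norm g"])
    show "conj_scalar (t (r *\<^sub>R e)) = r *\<^sub>R conj_scalar (t e)" for r e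
      using t_smul[of "of_real r" e]
      by (simp add: V.smul_of_real conj_scalar_of_real conj_scalar_mult scaleR_conv_of_real)
  qed (use t_norm in \<open>simp_all add: t_add conj_scalar_add mult.commute\<close>)
  then have F: "blinfun_apply F e = conj_scalar (t e)" for e
    by (simp add: F_def bounded_linear_Blinfun_apply)
  have "Vector_Spaces.linear smul (*) (blinfun_apply F)"
    by unfold_locales
      (simp_all add: F t_add conj_scalar_add t_smul conj_scalar_mult algebra_simps)
  then have "F \<in> dual_space smul" by (simp add: dual_space_def)
  moreover have "norm F = norm g"
  proof (rule antisym)
    show "norm F \<le> norm g"
      using t_norm by (intro norm_blinfun_bound) (simp_all add: F)
    have "norm (blinfun_apply g e) \<le> norm F * norm e" for e
    proof -
      have "norm (blinfun_apply g e) \<le> norm (t e)"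
        using t[of e 1] Cauchy_Schwarz_ineq2[of "t e" 1] by simp
      also have "\<dots> \<le> norm F * norm e"
        using norm_blinfun[of F e] by (simp add: F)
      finally show ?thesis .
    qed
    then show "norm g \<le> norm F" by (intro norm_blinfun_bound) simp_all
  qed
  moreover have "(norm (blinfun_apply F e))\<^sup>2 = (\<Sum>b\<in>Basis. (blinfun_apply g (smul b e))\<^sup>2)" for e
  proof -
    have "(norm (blinfun_apply F e))\<^sup>2 = inner (t e) (t e)"
      by (simp add: F power2_norm_eq_inner[symmetric])
    also have "\<dots> = (\<Sum>b\<in>Basis. inner (t e) b * inner (t e) b)"
      by (rule euclidean_inner)
    finally show ?thesis by (simp only: t power2_eq_square)
  qed
  ultimately show ?thesis by (rule that)
qed

lemma infinite_dimensional_real: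
  fixes smul :: "'k :: {real_normed_field, euclidean_space} \<Rightarrow> 'a :: banach \<Rightarrow> 'a"
  assumes "banach_space_over smul" "infinite_dimensional smul"
  shows "\<not> (\<exists>B :: 'a set. finite B \<and> span B = UNIV)"
proof
  interpret V: banach_space_over smul by fact
  assume "\<exists>B :: 'a set. finite B \<and> span B = UNIV"
  then obtain B :: "'a set" where B: "finite B" "span B = UNIV" by blast
  have "r *\<^sub>R x \<in> V.span B" if "x \<in> V.span B" for r x
    using V.span_scale[OF that, of "of_real r"] by (simp add: V.smul_of_real)
  then have "subspace (V.span B)"
    by (intro subspaceI V.span_zero V.span_add)
  then have "span B \<subseteq> V.span B"
    using V.span_superset by (intro span_minimal)
  with B assms(2) show False unfolding infinite_dimensional_def by auto
qed


section \<open>Consecutive intervals carrying lists\<close>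

text \<open>
  Positions start at \<open>1\<close>, and the list with index \<open>0\<close> is left out. The map \<open>h\<close> shifts the positions in
  the \<open>m\<close>-th list to the interval that it occupies.
\<close>

lemma concatenate_lists:
  fixes ys :: "nat \<Rightarrow> 'b list"
  assumes nonempty: "\<And>m. m \<ge> 1 \<Longrightarrow> ys m \<noteq> []"
  obtains f :: "nat \<Rightarrow> 'b" and I :: "nat \<Rightarrow> nat set"
  where "\<And>m. m \<ge> 1 \<Longrightarrow> \<exists>a b. 1 \<le> a \<and> a \<le> b \<and> I m = {a..b}"
    "disjoint_family_on I {1..}" "(\<Union>m\<in>{1..}. I m) = {1..}"
    "\<And>m. m \<ge> 1 \<Longrightarrow> \<exists>h. bij_betw h {..<length (ys m)} (I m) \<and> (\<forall>j<length (ys m). f (h j) = ys m ! j)"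
proof -
  define s where "s m = (\<Sum>i<m. length (ys (Suc i)))" for m
  define I where "I m = {Suc (s (m - 1))..s m}" for m
  define blk where "blk k = (LEAST m. k \<le> s m)" for k
  define f where "f k = ys (blk k) ! (k - Suc (s (blk k - 1)))" for k
  have s_Suc: "s (Suc m) = s m + length (ys (Suc m))" for m by (simp add: s_def)
  have mono: "s i \<le> s j" if "i \<le> j" for i j
    using that by (rule lift_Suc_mono_le[rotated]) (simp add: s_Suc)
  have ge: "m \<le> s m" for m
  proof (induction m)
    case (Suc m)
    then show ?case using nonempty[of "Suc m"] by (cases "ys (Suc m)") (auto simp: s_Suc)
  qed simp
  have blk_eq: "blk k = m" if "k \<in> I m" for k m
    unfolding blk_def
  proof (rule Least_equality)
    show "k \<le> s m" using that by (simp add: I_def)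
    fix i assume "k \<le> s i"
    then have "\<not> i \<le> m - 1" using mono[of i "m - 1"] that by (auto simp: I_def)
    then show "m \<le> i" by simp
  qed
  have blk: "k \<in> I (blk k)" "blk k \<ge> 1" if "k \<ge> 1" for k
  proof -
    have k: "k \<le> s (blk k)" unfolding blk_def using ge by (rule LeastI)
    show b: "blk k \<ge> 1"
    proof (rule ccontr)
      assume "\<not> blk k \<ge> 1"
      then have "blk k = 0" by simp
      with k that show False by (simp add: s_def)
    qed
    then have "\<not> k \<le> s (blk k - 1)"
      unfolding blk_def by (intro not_less_Least) simp
    with k show "k \<in> I (blk k)" by (simp add: I_def)
  qed
  show ?thesis
  proof
    show "\<exists>a b. 1 \<le> a \<and> a \<le> b \<and> I m = {a..b}" if "m \<ge> 1" for m
      using that nonempty[OF that] s_Suc[of "m - 1"]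
      by (intro exI[of _ "Suc (s (m - 1))"] exI[of _ "s m"]) (auto simp: I_def Suc_le_eq)
    show "disjoint_family_on I {1..}"
      unfolding disjoint_family_on_def using blk_eq by blast
    show "(\<Union>m\<in>{1..}. I m) = {1..}"
    proof
      show "{1..} \<subseteq> (\<Union>m\<in>{1..}. I m)" using blk by blast
    qed (auto simp: I_def)
    show "\<exists>h. bij_betw h {..<length (ys m)} (I m) \<and> (\<forall>j<length (ys m). f (h j) = ys m ! j)"
      if "m \<ge> 1" for m
    proof (intro exI conjI allI impI)
      let ?h = "\<lambda>j. Suc (s (m - 1) + j)"
      have sm: "s m = s (m - 1) + length (ys m)" using s_Suc[of "m - 1"] that by simp
      show "bij_betw ?h {..<length (ys m)} (I m)"
        by (rule bij_betwI[of _ _ _ "\<lambda>k. k - Suc (s (m - 1))"]) (auto simp: I_def sm)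
      show "f (?h j) = ys m ! j" if "j < length (ys m)" for j
      proof -
        have "?h j \<in> I m" using that by (simp add: I_def sm)
        then show ?thesis unfolding f_def blk_eq[OF \<open>?h j \<in> I m\<close>] by simp
      qed
    qed
  qed
qed

section \<open>Functionals that are rarely large\<close>

text \<open>
  Chebyshev's inequality for the counting measure on the list. For a unit vector \<open>e\<close> the multiples by
  basis scalars are unit vectors, so the squares of the extensions sum up to at most \<open>DIM('k)\<close>
  times the bound for the real functionals.
\<close>

lemma rarely_large_functionals:
  fixes smul :: "'k :: {real_normed_field, euclidean_space} \<Rightarrow> 'a :: banach \<Rightarrow> 'a"
  assumes V: "banach_space_over smul" "infinite_dimensional smul" and \<epsilon>: "0 < \<epsilon>" and \<eta>: "0 < \<eta>"
  obtains ys :: "('a \<Rightarrow>\<^sub>L 'k) list" where "ys \<noteq> []"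
    "\<And>F. F \<in> set ys \<Longrightarrow> F \<in> dual_space smul \<and> norm F = 1"
    "\<And>e. norm e = 1 \<Longrightarrow>
      real (card {j. j < length ys \<and> \<epsilon> \<le> norm (blinfun_apply (ys ! j) e)}) \<le> \<eta> * real (length ys)"
proof -
  interpret V: banach_space_over smul by fact
  define \<delta> where "\<delta> = \<eta> * \<epsilon>\<^sup>2 / DIM('k)"
  have \<delta>: "0 < \<delta>" using \<epsilon> \<eta> by (simp add: \<delta>_def)
  obtain gs :: "('a \<Rightarrow>\<^sub>L real) list" where gs: "gs \<noteq> []" "\<And>g. g \<in> set gs \<Longrightarrow> norm g = 1"
    "\<And>e. norm e \<le> 1 \<Longrightarrow> (\<Sum>g\<leftarrow>gs. (blinfun_apply g e)\<^sup>2) \<le> \<delta> * real (length gs)"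
    using square_summing_unit_functionals[OF infinite_dimensional_real[OF V] \<delta>] by blast
  have "\<exists>F :: 'a \<Rightarrow>\<^sub>L 'k. F \<in> dual_space smul \<and> norm F = norm g \<and>
      (\<forall>e. (norm (blinfun_apply F e))\<^sup>2 = (\<Sum>b\<in>Basis. (blinfun_apply g (smul b e))\<^sup>2))" for g
    by (rule scalar_extension[OF V(1), of g]) blast
  then obtain ext :: "('a \<Rightarrow>\<^sub>L real) \<Rightarrow> 'a \<Rightarrow>\<^sub>L 'k" where ext: "\<And>g. ext g \<in> dual_space smul"
    "\<And>g. norm (ext g) = norm g"
    "\<And>g e. (norm (blinfun_apply (ext g) e))\<^sup>2 = (\<Sum>b\<in>Basis. (blinfun_apply g (smul b e))\<^sup>2)"
    by metis
  show ?thesis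
  proof (rule that[of "map ext gs"])
    show "map ext gs \<noteq> []" using gs(1) by simp
    show "F \<in> dual_space smul \<and> norm F = 1" if "F \<in> set (map ext gs)" for F
      using that ext gs(2) by auto
    fix e :: 'a assume e: "norm e = 1"
    define N where "N = length gs"
    define J where "J = {j. j < N \<and> \<epsilon> \<le> norm (blinfun_apply (ext (gs ! j)) e)}"
    have "(\<Sum>j<N. (norm (blinfun_apply (ext (gs ! j)) e))\<^sup>2)
        = (\<Sum>b\<in>Basis. \<Sum>g\<leftarrow>gs. (blinfun_apply g (smul b e))\<^sup>2)"
      unfolding ext(3) by (subst sum.swap) (simp add: N_def sum_list_sum_nth atLeast0LessThan)
    also have "\<dots> \<le> (\<Sum>b\<in>(Basis :: 'k set). \<delta> * N)"
      unfolding N_def using e by (intro sum_mono gs(3)) (simp add: V.norm_smul)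
    also have "\<dots> = \<eta> * \<epsilon>\<^sup>2 * N" by (simp add: \<delta>_def)
    finally have total: "(\<Sum>j<N. (norm (blinfun_apply (ext (gs ! j)) e))\<^sup>2) \<le> \<eta> * \<epsilon>\<^sup>2 * N" .
    have "card J * \<epsilon>\<^sup>2 = (\<Sum>j\<in>J. \<epsilon>\<^sup>2)" by simp
    also have "\<dots> \<le> (\<Sum>j\<in>J. (norm (blinfun_apply (ext (gs ! j)) e))\<^sup>2)"
      using \<epsilon> by (intro sum_mono power_mono) (auto simp: J_def)
    also have "\<dots> \<le> (\<Sum>j<N. (norm (blinfun_apply (ext (gs ! j)) e))\<^sup>2)"
      by (intro sum_mono2) (auto simp: J_def)
    also note total
    finally have "card J * \<epsilon>\<^sup>2 \<le> (\<eta> * N) * \<epsilon>\<^sup>2" by (simp add: algebra_simps)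
    then have "real (card J) \<le> \<eta> * N" using \<epsilon> by simp
    moreover have "{j. j < length (map ext gs) \<and> \<epsilon> \<le> norm (blinfun_apply (map ext gs ! j) e)} = J"
      by (auto simp: J_def N_def)
    ultimately show "real (card {j. j < length (map ext gs) \<and>
        \<epsilon> \<le> norm (blinfun_apply (map ext gs ! j) e)}) \<le> \<eta> * real (length (map ext gs))"
      by (simp add: N_def)
  qed
qed

theorem proposition0p2:
  fixes smul :: "'k :: {real_normed_field, euclidean_space} \<Rightarrow> 'a :: banach \<Rightarrow> 'a"
  assumes "banach_space_over smul"
    and "infinite_dimensional smul"
  shows "\<exists>(f :: nat \<Rightarrow> 'a \<Rightarrow>\<^sub>L 'k) (I :: nat \<Rightarrow> nat set).
      (\<forall>k\<ge>1. f k \<in> dual_space smul \<and> norm (f k) = 1) \<and>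
      (\<forall>m\<ge>1. \<exists>a b. 1 \<le> a \<and> a \<le> b \<and> I m = {a..b}) \<and>
      disjoint_family_on I {1..} \<and>
      (\<Union>m\<in>{1..}. I m) = {1..} \<and>
      (\<forall>e :: 'a. norm e = 1 \<longrightarrow>
        (\<lambda>m. real (card {i \<in> I m. norm (blinfun_apply (f i) e) \<ge> 1 / real m}) / real (card (I m)))
          summable_on {1..})"
proof -
  define good where "good m ys \<longleftrightarrow> ys \<noteq> [] \<and> (\<forall>F\<in>set ys. F \<in> dual_space smul \<and> norm F = 1) \<and>
      (\<forall>e. norm e = 1 \<longrightarrow> real (card {j. j < length ys \<and> 1 / real m \<le> norm (blinfun_apply (ys ! j) e)})
        \<le> 1 / real m ^ 2 * real (length ys))" for m :: nat and ys :: "('a \<Rightarrow>\<^sub>L 'k) list"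
  have "\<exists>ys. good m ys" if "m \<ge> 1" for m
  proof -
    have pos: "0 < 1 / real m" "0 < 1 / real m ^ 2" using that by auto
    show ?thesis
      by (rule rarely_large_functionals[OF assms pos]) (auto simp: good_def)
  qed
  then have "\<forall>m\<in>{1..}. \<exists>ys. good m ys" by simp
  then obtain ys where good: "\<forall>m\<in>{1..}. good m (ys m)" by (rule bchoice[THEN exE])
  then have ys: "ys m \<noteq> []" "F \<in> set (ys m) \<Longrightarrow> F \<in> dual_space smul \<and> norm F = 1"
    "norm e = 1 \<Longrightarrow> real (card {j. j < length (ys m) \<and> 1 / real m \<le> norm (blinfun_apply (ys m ! j) e)})
        \<le> 1 / real m ^ 2 * real (length (ys m))" if "m \<ge> 1" for m F e
    using that unfolding good_def by simp_all
  obtain f :: "nat \<Rightarrow> 'a \<Rightarrow>\<^sub>L 'k" and I :: "nat \<Rightarrow> nat set" where I: "\<And>m. m \<ge> 1 \<Longrightarrow> \<exists>a b. 1 \<le> a \<and> a \<le> b \<and> I m = {a..b}"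
      "disjoint_family_on I {1..}" "(\<Union>m\<in>{1..}. I m) = {1..}"
    and fI: "\<And>m. m \<ge> 1 \<Longrightarrow>
      \<exists>h. bij_betw h {..<length (ys m)} (I m) \<and> (\<forall>j<length (ys m). f (h j) = ys m ! j)"
    by (rule concatenate_lists[of ys, OF ys(1)]) (assumption, rule that)
  from fI have "\<forall>m\<in>{1..}. \<exists>h. bij_betw h {..<length (ys m)} (I m) \<and> (\<forall>j<length (ys m). f (h j) = ys m ! j)"
    by simp
  then obtain h where "\<forall>m\<in>{1..}. bij_betw (h m) {..<length (ys m)} (I m) \<and>
      (\<forall>j<length (ys m). f (h m j) = ys m ! j)"
    by (rule bchoice[THEN exE])
  then have h: "bij_betw (h m) {..<length (ys m)} (I m)"
    "j < length (ys m) \<Longrightarrow> f (h m j) = ys m ! j" if "m \<ge> 1" for m j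
    using that by simp_all
  have "f k \<in> dual_space smul \<and> norm (f k) = 1" if "k \<ge> 1" for k
  proof -
    have "k \<in> (\<Union>m\<in>{1..}. I m)" unfolding I(3) using that by simp
    then obtain m where m: "m \<ge> 1" "k \<in> I m" by auto
    then obtain j where "j < length (ys m)" "k = h m j"
      using h(1)[OF m(1)] unfolding bij_betw_def by auto
    then show ?thesis using ys(2)[OF m(1)] h(2)[OF m(1)] by simp
  qed
  moreover have "(\<lambda>m. real (card {i \<in> I m. norm (blinfun_apply (f i) e) \<ge> 1 / real m}) / real (card (I m)))
      summable_on {1..}" if e: "norm e = 1" for e :: 'a
  proof (rule summable_on_comparison_test)
    have "summable (\<lambda>m. norm (1 / real m ^ 2))"
      using inverse_power_summable[of 2, where 'a = real] by (simp add: inverse_eq_divide)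
    then have "(\<lambda>m. 1 / real m ^ 2) summable_on UNIV" by (rule norm_summable_imp_summable_on)
    then show "(\<lambda>m. 1 / real m ^ 2) summable_on {1..}"
      by (rule summable_on_subset_banach) simp
    fix m :: nat assume "m \<in> {1..}"
    then have m: "m \<ge> 1" by simp
    let ?J = "{j. j < length (ys m) \<and> 1 / m \<le> norm (blinfun_apply (ys m ! j) e)}"
    have "{i \<in> I m. norm (blinfun_apply (f i) e) \<ge> 1 / real m} = h m ` ?J"
    proof (intro equalityI subsetI)
      fix i assume i: "i \<in> {i \<in> I m. norm (blinfun_apply (f i) e) \<ge> 1 / real m}"
      then obtain j where "j < length (ys m)" "i = h m j"
        using h(1)[OF m] unfolding bij_betw_def by auto
      with i show "i \<in> h m ` ?J" using h(2)[OF m] by auto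
    qed (use h(1)[OF m] h(2)[OF m] in \<open>auto simp: bij_betw_def\<close>)
    moreover have "inj_on (h m) ?J"
      using h(1)[OF m] unfolding bij_betw_def by (auto intro: inj_on_subset)
    ultimately have "card {i \<in> I m. norm (blinfun_apply (f i) e) \<ge> 1 / real m} = card ?J"
      by (simp add: card_image)
    moreover have "card (I m) = length (ys m)"
      using bij_betw_same_card[OF h(1)[OF m]] by simp
    ultimately show "real (card {i \<in> I m. norm (blinfun_apply (f i) e) \<ge> 1 / real m}) / real (card (I m))
        \<le> 1 / real m ^ 2"
      using ys(3)[OF m e] ys(1)[OF m] by (simp add: pos_divide_le_eq)
  qed simp
  ultimately show ?thesis using I by blast
qed

end
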